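(* Let $P$ be a lattice-ordered algebra of S-probabilities on a set $S$, let $\mathbf R=(P,\oplus,\odot,0,1)$ be the RLSE associated to $P$, and let $p,q\in P$. Then, with $+$ and $-$ denoting pointwise sum and difference of real functions: (i) $p\oplus q=p\odot(1-q)+(1-p)\odot q$; (ii) $p\oplus q=q-p$ if $p\leq q$; (iii) $p\oplus1=1-p$; (iv) $p\oplus q=p+q$ if $p\perp q$.
   Context: Let $S$ be a set. An S-probability is a function $p\colon S\to[0,1]$. Functions are ordered pointwise by $\leq$; $0,1$ also denote the constant functions; $p':=1-p$; and $p\perp q$ means $p\leq q'$. A set $P$ of S-probabilities is an algebra of S-probabilities if (S1) $0,1\in P$; (S2) $p'\in P$ for every $p\in P$; (S3) if $p,q,r\in P$ satisfy $p\perp q\perp r\perp p$ then $p+q+r\in P$ (pointwise sum). It is lattice-ordered if $(P,\leq)$ is a lattice; $\vee,\wedge$ denote the supremum and infimum in $(P,\leq)$ (not necessarily pointwise maximum/minimum). The RLSE associated to a lattice-ordered algebra of S-probabilities $P$ is $(P,\oplus,\odot,0,1)$ with $p\oplus q:=(p\wedge q')\vee(p'\wedge q)$ and $p\odot q:=p\wedge q$ for $p,q\in P$. The operation $\odot$ binds more strongly than $+$. *)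

theory Defs
  imports Complex_Main "HOL-Library.FuncSet" "HOL-Algebra.Lattice" "HOL-Algebra.Ring"
begin

text \<open>
  Functions on the set \<open>S\<close> are represented by extensional functions (value \<open>undefined\<close>
  outside \<open>S\<close>), so that HOL equality is equality of functions on \<open>S\<close>, and \<open>S\<close> may be empty.
\<close>

definition sprob :: "'s set \<Rightarrow> ('s \<Rightarrow> real) set" where
  "sprob S = S \<rightarrow>\<^sub>E {0..1}"

definition const_on :: "'s set \<Rightarrow> real \<Rightarrow> 's \<Rightarrow> real" where
  "const_on S c = (\<lambda>x\<in>S. c)"

definition plus_on :: "'s set \<Rightarrow> ('s \<Rightarrow> real) \<Rightarrow> ('s \<Rightarrow> real) \<Rightarrow> 's \<Rightarrow> real" where
  "plus_on S p q = (\<lambda>x\<in>S. p x + q x)"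

definition minus_on :: "'s set \<Rightarrow> ('s \<Rightarrow> real) \<Rightarrow> ('s \<Rightarrow> real) \<Rightarrow> 's \<Rightarrow> real" where
  "minus_on S p q = (\<lambda>x\<in>S. p x - q x)"

definition le_on :: "'s set \<Rightarrow> ('s \<Rightarrow> real) \<Rightarrow> ('s \<Rightarrow> real) \<Rightarrow> bool" where
  "le_on S p q \<longleftrightarrow> (\<forall>x\<in>S. p x \<le> q x)"

definition compl_on :: "'s set \<Rightarrow> ('s \<Rightarrow> real) \<Rightarrow> 's \<Rightarrow> real" where
  "compl_on S p = minus_on S (const_on S 1) p"

definition orth_on :: "'s set \<Rightarrow> ('s \<Rightarrow> real) \<Rightarrow> ('s \<Rightarrow> real) \<Rightarrow> bool" where
  "orth_on S p q \<longleftrightarrow> le_on S p (compl_on S q)"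

definition sprob_algebra :: "'s set \<Rightarrow> ('s \<Rightarrow> real) set \<Rightarrow> bool" where
  "sprob_algebra S P \<longleftrightarrow>
     P \<subseteq> sprob S \<and>
     const_on S 0 \<in> P \<and> const_on S 1 \<in> P \<and>
     (\<forall>p\<in>P. compl_on S p \<in> P) \<and>
     (\<forall>p\<in>P. \<forall>q\<in>P. \<forall>r\<in>P. orth_on S p q \<and> orth_on S q r \<and> orth_on S r p \<longrightarrow>
        plus_on S (plus_on S p q) r \<in> P)"

definition sprob_order :: "'s set \<Rightarrow> ('s \<Rightarrow> real) set \<Rightarrow> ('s \<Rightarrow> real) gorder" where
  "sprob_order S P = \<lparr>carrier = P, eq = (=), le = le_on S\<rparr>"

definition lattice_ordered_sprob_algebra :: "'s set \<Rightarrow> ('s \<Rightarrow> real) set \<Rightarrow> bool" where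
  "lattice_ordered_sprob_algebra S P \<longleftrightarrow> sprob_algebra S P \<and> lattice (sprob_order S P)"

text \<open>
  The associated RLSE only borrows the signature of the record type \<open>ring\<close>;
  it is not a ring in general. Joins and meets are those of the poset \<open>P\<close>.
\<close>

definition RLSE :: "'s set \<Rightarrow> ('s \<Rightarrow> real) set \<Rightarrow> ('s \<Rightarrow> real) ring" where
  "RLSE S P =
     \<lparr>carrier = P,
      mult = (\<lambda>p q. p \<sqinter>\<^bsub>sprob_order S P\<^esub> q),
      one = const_on S 1,
      zero = const_on S 0,
      add = (\<lambda>p q. (p \<sqinter>\<^bsub>sprob_order S P\<^esub> compl_on S q)
                     \<squnion>\<^bsub>sprob_order S P\<^esub> (compl_on S p \<sqinter>\<^bsub>sprob_order S P\<^esub> q))\<rparr>"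

end

theory Submission
  imports Defs
begin

text \<open>
  If \<open>p \<perp> q\<close>, then \<open>p + q\<close> is the join of \<open>p\<close> and \<open>q\<close>: for an upper bound \<open>r\<close>, the
  elements \<open>p, q, r'\<close> are pairwise orthogonal, so \<open>p + q + r' \<in> P\<close> is at most \<open>1\<close>,
  that is \<open>p + q \<le> r\<close>. All four identities follow from this, by duality in the case of
  \<open>p' \<and> q = (p \<or> q')' = q - p\<close> and \<open>p \<and> q' \<le> q \<and> q' = (q' \<or> q)' = 0\<close> for \<open>p \<le> q\<close>.
\<close>

lemma const_on_apply [simp]: "x \<in> S \<Longrightarrow> const_on S c x = c"
  by (simp add: const_on_def)

lemma plus_on_apply [simp]: "x \<in> S \<Longrightarrow> plus_on S p q x = p x + q x"
  by (simp add: plus_on_def)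

lemma minus_on_apply [simp]: "x \<in> S \<Longrightarrow> minus_on S p q x = p x - q x"
  by (simp add: minus_on_def)

lemma compl_on_apply [simp]: "x \<in> S \<Longrightarrow> compl_on S p x = 1 - p x"
  by (simp add: compl_on_def)

text \<open>This form is symmetric in \<open>p\<close> and \<open>q\<close>, so orthogonality may be
  read in either order.\<close>

lemma orth_on_iff: "orth_on S p q \<longleftrightarrow> (\<forall>x\<in>S. p x + q x \<le> 1)"
  by (auto simp: orth_on_def le_on_def)

locale lattice_sprob_algebra =
  fixes S :: "'s set" and P :: "('s \<Rightarrow> real) set"
  assumes lattice_ordered: "lattice_ordered_sprob_algebra S P"
begin

abbreviation join_P (infixl "\<squnion>\<^sub>P" 65) where "p \<squnion>\<^sub>P q \<equiv> p \<squnion>\<^bsub>sprob_order S P\<^esub> q"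
abbreviation meet_P (infixl "\<sqinter>\<^sub>P" 70) where "p \<sqinter>\<^sub>P q \<equiv> p \<sqinter>\<^bsub>sprob_order S P\<^esub> q"

sublocale P: lattice "sprob_order S P"
  rewrites "carrier (sprob_order S P) = P" and "le (sprob_order S P) = le_on S"
  using lattice_ordered
  by (simp_all add: lattice_ordered_sprob_algebra_def sprob_order_def)

lemma algebra: "sprob_algebra S P"
  using lattice_ordered by (simp add: lattice_ordered_sprob_algebra_def)

lemma const_closed: "const_on S 0 \<in> P" "const_on S 1 \<in> P"
  and compl_closed: "p \<in> P \<Longrightarrow> compl_on S p \<in> P"
  using algebra by (auto simp: sprob_algebra_def)

lemma bounds:
  assumes "p \<in> P" "x \<in> S"
  shows "0 \<le> p x" "p x \<le> 1"
  using algebra assms by (fastforce simp: sprob_algebra_def sprob_def)+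

text \<open>Agreement on \<open>S\<close> gives both inequalities, and antisymmetry of the order on
  \<open>P\<close> makes them an equality of functions.\<close>

lemma eqI:
  assumes "p \<in> P" "q \<in> P" "\<And>x. x \<in> S \<Longrightarrow> p x = q x"
  shows "p = q"
  by (intro P.le_antisym) (auto simp: assms le_on_def)

lemma plus3_closed:
  assumes "p \<in> P" "q \<in> P" "r \<in> P" "orth_on S p q" "orth_on S q r" "orth_on S r p"
  shows "plus_on S (plus_on S p q) r \<in> P"
  using algebra assms by (auto simp: sprob_algebra_def)

lemma plus_closed:
  assumes "p \<in> P" "q \<in> P" "orth_on S p q"
  shows "plus_on S p q \<in> P"
proof -
  \<comment> \<open>The third summand 0 is orthogonal to every element of \<open>P\<close>.\<close>
  have "plus_on S (plus_on S p q) (const_on S 0) \<in> P"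
    using assms by (intro plus3_closed) (auto simp: const_closed orth_on_iff bounds)
  moreover have "plus_on S (plus_on S p q) (const_on S 0) = plus_on S p q"
    by (auto simp: plus_on_def const_on_def)
  ultimately show ?thesis by simp
qed

lemma join_orth:
  assumes "p \<in> P" "q \<in> P" "orth_on S p q"
  shows "p \<squnion>\<^sub>P q = plus_on S p q"
proof (rule P.le_antisym)
  show "le_on S (p \<squnion>\<^sub>P q) (plus_on S p q)"
    using assms by (intro P.join_le plus_closed) (auto simp: le_on_def bounds)
  let ?r = "p \<squnion>\<^sub>P q"
  have r: "?r \<in> P" "le_on S p ?r" "le_on S q ?r"
    using assms P.join_left P.join_right by auto
  \<comment> \<open>The complement of \<open>?r\<close> is orthogonal to \<open>p\<close> and
    \<open>q\<close> because \<open>?r\<close> is an upper bound of both.\<close>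
  have "plus_on S (plus_on S p q) (compl_on S ?r) \<in> P"
    using assms r by (intro plus3_closed compl_closed) (auto simp: orth_on_iff le_on_def)
  from bounds(2)[OF this] show "le_on S (plus_on S p q) ?r"
    by (fastforce simp: le_on_def)
qed (use assms plus_closed in auto)

lemma compl_compl: "p \<in> P \<Longrightarrow> compl_on S (compl_on S p) = p"
  by (rule eqI) (auto simp: compl_closed)

text \<open>De Morgan's law: the complement is an order-reversing involution of \<open>P\<close>, so
  it exchanges joins and meets.\<close>

lemma meet_eq_compl_join:
  assumes "p \<in> P" "q \<in> P"
  shows "p \<sqinter>\<^sub>P q = compl_on S (compl_on S p \<squnion>\<^sub>P compl_on S q)"
proof (rule P.le_antisym)
  note [simp] = assms compl_closed
  let ?j = "compl_on S p \<squnion>\<^sub>P compl_on S q"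
  have anti: "le_on S a (compl_on S b) \<Longrightarrow> le_on S b (compl_on S a)" for a b
    by (force simp: le_on_def)
  have "le_on S (compl_on S p) (compl_on S (p \<sqinter>\<^sub>P q))" "le_on S (compl_on S q) (compl_on S (p \<sqinter>\<^sub>P q))"
    using P.meet_left[of p q] P.meet_right[of p q] by (auto simp: le_on_def)
  then show "le_on S (p \<sqinter>\<^sub>P q) (compl_on S ?j)"
    by (intro anti[OF P.join_le]) auto
  have "le_on S (compl_on S ?j) (compl_on S (compl_on S p))"
    "le_on S (compl_on S ?j) (compl_on S (compl_on S q))"
    using P.join_left[of "compl_on S p" "compl_on S q"] P.join_right[of "compl_on S p" "compl_on S q"]
    by (auto simp: le_on_def)
  then show "le_on S (compl_on S ?j) (p \<sqinter>\<^sub>P q)"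
    by (intro P.meet_le) (auto simp: compl_compl)
qed (use assms compl_closed in auto)

text \<open>By De Morgan the meet is the complement of the join of \<open>p\<close> and
  \<open>compl_on S q\<close>. These are orthogonal exactly when p \<le> q, so their join is the sum
  p + 1 - q.\<close>

lemma meet_compl_left:
  assumes "p \<in> P" "q \<in> P" "le_on S p q"
  shows "compl_on S p \<sqinter>\<^sub>P q = minus_on S q p"
proof -
  have "compl_on S p \<sqinter>\<^sub>P q = compl_on S (p \<squnion>\<^sub>P compl_on S q)"
    using assms by (simp add: meet_eq_compl_join compl_closed compl_compl)
  also have "p \<squnion>\<^sub>P compl_on S q = plus_on S p (compl_on S q)"
    using assms by (intro join_orth) (auto simp: compl_closed orth_on_iff le_on_def)
  also have "compl_on S (plus_on S p (compl_on S q)) = minus_on S q p"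
    by (auto simp: fun_eq_iff compl_on_def minus_on_def plus_on_def const_on_def)
  finally show ?thesis .
qed

text \<open>Since p \<le> q, the meet lies below both \<open>q\<close> and its complement, whose
  meet is q - q = 0 by \<open>meet_compl_left\<close>.\<close>

lemma meet_compl_right:
  assumes "p \<in> P" "q \<in> P" "le_on S p q"
  shows "p \<sqinter>\<^sub>P compl_on S q = const_on S 0"
proof (rule eqI)
  note [simp] = assms compl_closed
  fix x assume x: "x \<in> S"
  let ?m = "p \<sqinter>\<^sub>P compl_on S q"
  have "le_on S ?m q"
    using P.meet_left[of p "compl_on S q"] assms(3) by (fastforce simp: le_on_def)
  then have "le_on S ?m (compl_on S q \<sqinter>\<^sub>P q)"
    using P.meet_right[of p "compl_on S q"] by (intro P.meet_le) auto
  also have "compl_on S q \<sqinter>\<^sub>P q = minus_on S q q"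
    by (rule meet_compl_left) (auto simp: le_on_def)
  finally show "?m x = const_on S 0 x"
    using x bounds(1)[of ?m x] by (auto simp: le_on_def)
qed (use assms const_closed compl_closed in auto)

text \<open>The first meet is below \<open>p\<close> and the second below
  \<open>compl_on S p\<close>, so they are orthogonal and their join is their sum.\<close>

lemma sum_eq_plus:
  assumes "p \<in> P" "q \<in> P"
  shows "(p \<sqinter>\<^sub>P compl_on S q) \<squnion>\<^sub>P (compl_on S p \<sqinter>\<^sub>P q)
    = plus_on S (p \<sqinter>\<^sub>P compl_on S q) (compl_on S p \<sqinter>\<^sub>P q)"
proof (rule join_orth)
  note [simp] = assms compl_closed
  show "orth_on S (p \<sqinter>\<^sub>P compl_on S q) (compl_on S p \<sqinter>\<^sub>P q)"
    using P.meet_left[of p "compl_on S q"] P.meet_left[of "compl_on S p" q]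
    by (fastforce simp: orth_on_iff le_on_def)
qed (use assms compl_closed in auto)

text \<open>Of the two summands, the first is 0 and the second is q - p.\<close>

lemma sum_le:
  assumes "p \<in> P" "q \<in> P" "le_on S p q"
  shows "(p \<sqinter>\<^sub>P compl_on S q) \<squnion>\<^sub>P (compl_on S p \<sqinter>\<^sub>P q) = minus_on S q p"
  using sum_eq_plus[OF assms(1,2)]
  by (simp add: meet_compl_left meet_compl_right assms)
    (auto simp: plus_on_def minus_on_def const_on_def)

lemma sum_orth:
  assumes "p \<in> P" "q \<in> P" "orth_on S p q"
  shows "(p \<sqinter>\<^sub>P compl_on S q) \<squnion>\<^sub>P (compl_on S p \<sqinter>\<^sub>P q) = plus_on S p q"
proof -
  note [simp] = assms compl_closed
  have "le_on S p (compl_on S q)" "le_on S q (compl_on S p)"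
    using assms(3) by (force simp: orth_on_iff le_on_def)+
  then have "p \<sqinter>\<^sub>P compl_on S q = p" "q \<sqinter>\<^sub>P compl_on S p = q"
    \<comment> \<open>The meet of an element with an upper bound of it is the element itself, so the
      two meets reduce to \<open>p\<close> and \<open>q\<close>.\<close>
    using P.le_iff_join[of p "compl_on S q"] P.le_iff_join[of q "compl_on S p"] by auto
  then show ?thesis by (simp add: join_orth meet_comm[of _ "compl_on S p" q])
qed

end

theorem proposition4p2:
  fixes S :: "'s set" and P :: "('s \<Rightarrow> real) set" and p q :: "'s \<Rightarrow> real"
    and R :: "('s \<Rightarrow> real) ring"
  assumes "lattice_ordered_sprob_algebra S P"
    and "R = RLSE S P"
    and "p \<in> P" and "q \<in> P"
  shows "(p \<oplus>\<^bsub>R\<^esub> q = plus_on S (p \<otimes>\<^bsub>R\<^esub> minus_on S \<one>\<^bsub>R\<^esub> q) (minus_on S \<one>\<^bsub>R\<^esub> p \<otimes>\<^bsub>R\<^esub> q)) \<and>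
    (le_on S p q \<longrightarrow> p \<oplus>\<^bsub>R\<^esub> q = minus_on S q p) \<and>
    (p \<oplus>\<^bsub>R\<^esub> \<one>\<^bsub>R\<^esub> = minus_on S \<one>\<^bsub>R\<^esub> p) \<and>
    (orth_on S p q \<longrightarrow> p \<oplus>\<^bsub>R\<^esub> q = plus_on S p q)"
proof -
  interpret lattice_sprob_algebra S P
    using assms(1) by unfold_locales
  \<comment> \<open>This makes the third identity the second one with 1 in place of
    \<open>q\<close>.\<close>
  have top: "le_on S p (const_on S 1)"
    using assms(3) by (auto simp: le_on_def bounds)
  show ?thesis
    using sum_eq_plus[OF assms(3,4)] sum_le[OF assms(3,4)] sum_orth[OF assms(3,4)]
      sum_le[OF assms(3) const_closed(2) top]
    \<comment> \<open>Folding \<open>compl_on_def\<close> turns the differences from 1 in the goal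
      into the complements used by the lemmas.\<close>
    by (simp add: assms(2) RLSE_def flip: compl_on_def)
qed

end
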